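(* Let $h$ be a positive integer. If $G$ is a finite simple chordal graph with maximum degree $\Delta(G)$, then $$\chi^h_{\mathrm{pcf}}(G) \le 1 + (h+1) \cdot \min \left\{ s(G)-1,\ \frac{\Delta(G)+h-1}{2}\right\}.$$
   Context: A proper $k$-coloring of $G$ assigns each vertex a color in $\{1,\dots,k\}$ so that adjacent vertices get different colors. For a vertex $v$, let $h_v=\min\{\deg_G(v),h\}$. A proper $h$-conflict-free $k$-coloring of $G$ is a proper $k$-coloring such that for every vertex $v$, at least $h_v$ distinct colors each appear exactly once on $N_G(v)$; $\chi^h_{\mathrm{pcf}}(G)$ is the minimum such $k$. A chordal graph $G$ on $n$ vertices has a simplicial ordering $v_1,\dots,v_n$: for each $i\in\{1,\dots,n\}$, $v_i$ together with its neighbors in $G[\{v_i,\dots,v_n\}]$ forms a clique. For such an ordering and a vertex $v_i$, the maximal clique containing $v_i$ in the subgraph induced by $\{v_i,v_{i+1},\dots,v_n\}$ is called a simplicial clique of $G$. $s(G)$ denotes the maximum size of all possible simplicial cliques of $G$ (over all simplicial orderings and all $i$). *)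

theory Defs
  imports Complex_Main "Graph_Theory.Graph_Theory"
begin

text \<open>
  A finite simple graph is a \<^locale>\<open>graph\<close>: a finite symmetric digraph without loops or
  parallel arcs, every undirected edge being represented by its two opposite arcs.
\<close>

definition nbhd :: "('a, 'b) pre_digraph \<Rightarrow> 'a \<Rightarrow> 'a set" where
  "nbhd G v = {u. v \<rightarrow>\<^bsub>G\<^esub> u}"

definition degree :: "('a, 'b) pre_digraph \<Rightarrow> 'a \<Rightarrow> nat" where
  "degree G v = card (nbhd G v)"

definition max_degree :: "('a, 'b) pre_digraph \<Rightarrow> nat" where
  "max_degree G = Max (degree G ` verts G)"

definition proper_coloring :: "('a, 'b) pre_digraph \<Rightarrow> nat \<Rightarrow> ('a \<Rightarrow> nat) \<Rightarrow> bool" where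
  "proper_coloring G k c \<longleftrightarrow>
     c ` verts G \<subseteq> {1..k} \<and> (\<forall>u v. u \<rightarrow>\<^bsub>G\<^esub> v \<longrightarrow> c u \<noteq> c v)"

definition unique_colors :: "('a, 'b) pre_digraph \<Rightarrow> ('a \<Rightarrow> nat) \<Rightarrow> 'a \<Rightarrow> nat set" where
  "unique_colors G c v = {a. \<exists>!u. u \<in> nbhd G v \<and> c u = a}"

definition proper_cf_coloring ::
    "('a, 'b) pre_digraph \<Rightarrow> nat \<Rightarrow> nat \<Rightarrow> ('a \<Rightarrow> nat) \<Rightarrow> bool" where
  "proper_cf_coloring G h k c \<longleftrightarrow>
     proper_coloring G k c \<and>
     (\<forall>v \<in> verts G. min (degree G v) h \<le> card (unique_colors G c v))"

definition chi_pcf :: "nat \<Rightarrow> ('a, 'b) pre_digraph \<Rightarrow> nat" where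
  "chi_pcf h G = (LEAST k. \<exists>c. proper_cf_coloring G h k c)"

text \<open>
  A chord of a cycle is an edge of the graph between two vertices of the cycle that is not
  an edge of the cycle. Cycles are arc lists here, so neither of the two arcs
  representing a chord may occur in the list. The closed walks of length two formed by opposite
  arcs, which \<^const>\<open>pre_digraph.cycle\<close> admits, are excluded by the length bound.
\<close>

definition has_chord :: "('a, 'b) pre_digraph \<Rightarrow> 'b list \<Rightarrow> bool" where
  "has_chord G p \<longleftrightarrow>
     (\<exists>u \<in> tail G ` set p. \<exists>w \<in> tail G ` set p. u \<rightarrow>\<^bsub>G\<^esub> w \<and>
        (u, w) \<notin> arc_to_ends G ` set p \<and> (w, u) \<notin> arc_to_ends G ` set p)"

definition chordal :: "('a, 'b) pre_digraph \<Rightarrow> bool" where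
  "chordal G \<longleftrightarrow> (\<forall>p. pre_digraph.cycle G p \<and> 4 \<le> length p \<longrightarrow> has_chord G p)"

definition is_clique :: "('a, 'b) pre_digraph \<Rightarrow> 'a set \<Rightarrow> bool" where
  "is_clique G K \<longleftrightarrow> K \<subseteq> verts G \<and> (\<forall>u \<in> K. \<forall>w \<in> K. u \<noteq> w \<longrightarrow> u \<rightarrow>\<^bsub>G\<^esub> w)"

definition maximal_clique :: "('a, 'b) pre_digraph \<Rightarrow> 'a set \<Rightarrow> bool" where
  "maximal_clique G K \<longleftrightarrow> is_clique G K \<and> (\<forall>L. is_clique G L \<and> K \<subseteq> L \<longrightarrow> L = K)"

definition simplicial_ordering :: "('a, 'b) pre_digraph \<Rightarrow> 'a list \<Rightarrow> bool" where
  "simplicial_ordering G vs \<longleftrightarrow>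
     distinct vs \<and> set vs = verts G \<and>
     (\<forall>i < length vs. let H = G \<restriction> set (drop i vs)
        in is_clique H (insert (vs ! i) (nbhd H (vs ! i))))"

definition simplicial_clique :: "('a, 'b) pre_digraph \<Rightarrow> 'a set \<Rightarrow> bool" where
  "simplicial_clique G K \<longleftrightarrow>
     (\<exists>vs i. simplicial_ordering G vs \<and> i < length vs \<and>
        vs ! i \<in> K \<and> maximal_clique (G \<restriction> set (drop i vs)) K)"

definition max_simplicial_clique :: "('a, 'b) pre_digraph \<Rightarrow> nat" where
  "max_simplicial_clique G = Max (card ` {K. simplicial_clique G K})"

end

theory Submission
  imports Defs
begin

text \<open>
  Colour the vertices greedily in the reverse of a simplicial ordering. If \<open>v\<close> has \<open>d\<close> already
  coloured neighbours, these form a clique \<open>N\<close>; it suffices that the colour of \<open>v\<close> avoids the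
  colours of \<open>N\<close> and, for each \<open>w \<in> N\<close>, at most \<open>h\<close> colours that are unique at \<open>w\<close>. This
  forbids at most \<open>d (h + 1)\<close> colours, and \<open>d \<le> s(G) - 1\<close>. If \<open>2 d \<ge> \<Delta> + h\<close>, the protected
  unique colours can all be chosen among those of \<open>N\<close>, so only \<open>d \<le> \<Delta>\<close> colours are
  forbidden.
\<close>

section \<open>Simplicial elimination\<close>

text \<open>The relation stays fixed while the vertex set \<open>W\<close> varies, so induced
  subgraphs are mere sets.\<close>

locale adjacency =
  fixes adj :: "'a \<Rightarrow> 'a \<Rightarrow> bool"
  assumes adj_sym: "adj u v \<Longrightarrow> adj v u"
    and adj_irrefl: "\<not> adj v v"
begin

text \<open>Only interior vertices are confined to \<open>D\<close>: later the ends are neighbours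
  of some \<open>v\<close>, while \<open>D\<close> avoids \<open>v\<close> and its
  neighbours.\<close>

definition walk_via :: "'a set \<Rightarrow> 'a \<Rightarrow> (nat \<Rightarrow> 'a) \<Rightarrow> nat \<Rightarrow> 'a \<Rightarrow> bool" where
  "walk_via D a p n b \<longleftrightarrow> p 0 = a \<and> p n = b \<and> (\<forall>i<n. adj (p i) (p (Suc i))) \<and>
     (\<forall>i. 0 < i \<and> i < n \<longrightarrow> p i \<in> D)"

definition simplicial :: "'a set \<Rightarrow> 'a \<Rightarrow> bool" where
  "simplicial W z \<longleftrightarrow> (\<forall>x\<in>W. \<forall>y\<in>W. adj z x \<and> adj z y \<and> x \<noteq> y \<longrightarrow> adj x y)"

definition nb :: "'a set \<Rightarrow> 'a \<Rightarrow> 'a set" where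
  "nb W w = {u \<in> W. adj w u}"

text \<open>A shortest walk works: at a repeated vertex or a chord a segment could be cut out, and
  the interior would still lie in \<open>D\<close>.\<close>

lemma induced_path_exists:
  assumes "walk_via D a p n b"
  obtains q m where "walk_via D a q m b" "inj_on q {..m}"
    "\<And>i j. i < j \<Longrightarrow> j \<le> m \<Longrightarrow> adj (q i) (q j) \<Longrightarrow> j = Suc i"
proof -
  define m where "m = (LEAST m. \<exists>q. walk_via D a q m b)"
  have "\<exists>q. walk_via D a q m b"
    unfolding m_def by (rule LeastI) (use assms in blast)
  then obtain q where q: "walk_via D a q m b" ..
  have short: "m \<le> m'" if "walk_via D a q' m' b" for q' m'
    unfolding m_def by (rule Least_le) (use that in blast)
  have neq: "q i \<noteq> q j" if ij: "i < j" "j \<le> m" for i j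
  proof
    assume eq: "q i = q j"
    define t where "t = j - i"
    have t: "0 < t" "j = i + t" using that by (auto simp: t_def)
    \<comment> \<open>Drops positions \<open>i + 1\<close> to \<open>j\<close>. Since
      \<open>q i = q j\<close>, the shifted formula also holds at \<open>k = i\<close>.\<close>
    define q' where "q' k = (if k \<le> i then q k else q (k + t))" for k
    have q'_shift: "q' k = q (k + t)" if "i \<le> k" for k
      using that eq t by (auto simp: q'_def)
    have "walk_via D a q' (m - t) b"
      unfolding walk_via_def
    proof (intro conjI allI impI)
      show "q' 0 = a" using q by (simp add: q'_def walk_via_def)
      show "q' (m - t) = b" using q that t by (simp add: q'_shift walk_via_def)
      show "adj (q' k) (q' (Suc k))" if k: "k < m - t" for k
      proof (cases "k < i")
        case True
        then show ?thesis using k q by (simp add: q'_def walk_via_def)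
      next
        case False
        then show ?thesis using k q by (simp add: q'_shift walk_via_def)
      qed
      show "q' k \<in> D" if "0 < k \<and> k < m - t" for k
        using that ij t q by (auto simp: q'_def walk_via_def)
    qed
    then show False using short[of q' "m - t"] that t by linarith
  qed
  have inj: "inj_on q {..m}"
    by (rule linorder_inj_onI) (use neq in auto)
  have ind: "j = Suc i" if ij: "i < j" "j \<le> m" "adj (q i) (q j)" for i j
  proof (rule ccontr)
    assume ne: "j \<noteq> Suc i"
    \<comment> \<open>The number of vertices that the chord bypasses.\<close>
    define t where "t = j - i - 1"
    have t: "0 < t" "j = i + 1 + t" using that ne by (auto simp: t_def)
    define q' where "q' k = (if k \<le> i then q k else q (k + t))" for k
    have "walk_via D a q' (m - t) b"
      unfolding walk_via_def
    proof (intro conjI allI impI)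
      show "q' 0 = a" using q by (simp add: q'_def walk_via_def)
      show "q' (m - t) = b" using q ij t by (auto simp: q'_def walk_via_def)
      show "adj (q' k) (q' (Suc k))" if k: "k < m - t" for k
      proof (cases "k = i")
        case True
        then show ?thesis using ij t by (simp add: q'_def)
      next
        case False
        then show ?thesis using k q by (simp add: q'_def walk_via_def)
      qed
      show "q' k \<in> D" if "0 < k \<and> k < m - t" for k
        using that ij t q by (auto simp: q'_def walk_via_def)
    qed
    then show False using short[of q' "m - t"] that t by linarith
  qed
  show thesis using that[OF q inj ind] .
qed

end

text \<open>Since \<open>q m = q 0\<close>, the pairs \<open>{q i, q (Suc i)}\<close> with
  \<open>i < m\<close> include the closing edge of the cycle.\<close>

locale chordal_adjacency = adjacency +
  assumes chord: "\<lbrakk>4 \<le> m; inj_on q {..<m}; q m = q 0; \<forall>i<m. adj (q i) (q (Suc i))\<rbrakk> \<Longrightarrow>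
    \<exists>x \<in> q ` {..<m}. \<exists>y \<in> q ` {..<m}. adj x y \<and> (\<forall>i<m. {x, y} \<noteq> {q i, q (Suc i)})"
begin

text \<open>Otherwise \<open>v\<close> and an induced path from \<open>a\<close> to \<open>b\<close>
  through \<open>D\<close> form a chordless cycle: interior vertices are not adjacent to
  \<open>v\<close>, and the path has no chord.\<close>

lemma adj_if_walk_avoiding_nb:
  assumes walk: "walk_via D a p n b" and va: "adj v a" and vb: "adj v b" and "a \<noteq> b"
    and D: "v \<notin> D" "\<forall>x\<in>D. \<not> adj v x"
  shows "adj a b"
proof (rule ccontr)
  assume nab: "\<not> adj a b"
  obtain p n where p: "walk_via D a p n b" and inj: "inj_on p {..n}"
    and ind: "\<And>i j. i < j \<Longrightarrow> j \<le> n \<Longrightarrow> adj (p i) (p j) \<Longrightarrow> j = Suc i"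
    using induced_path_exists[OF walk] by blast
  have p0: "p 0 = a" "p n = b" and padj: "\<And>i. i < n \<Longrightarrow> adj (p i) (p (Suc i))"
    and pD: "\<And>i. 0 < i \<Longrightarrow> i < n \<Longrightarrow> p i \<in> D"
    using p by (auto simp: walk_via_def)
  have "n \<noteq> 0" using p0 \<open>a \<noteq> b\<close> by metis
  moreover have "n \<noteq> 1" using p0 padj[of 0] nab by auto
  ultimately have n2: "2 \<le> n" by simp
  \<comment> \<open>The cycle \<open>v, p 0, ..., p n, v\<close>; its length \<open>n + 2\<close> is
    at least 4.\<close>
  define q where "q k = (if k = 0 \<or> k = n + 2 then v else p (k - 1))" for k
  have q0: "q 0 = v" "q (Suc (Suc n)) = v" and qS: "\<And>k. k \<le> n \<Longrightarrow> q (Suc k) = p k"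
    by (auto simp: q_def)
  have pv: "p k \<noteq> v" if "k \<le> n" for k
  proof -
    consider "k = 0" | "k = n" | "0 < k \<and> k < n" using \<open>k \<le> n\<close> by linarith
    then show ?thesis
      by cases (use p0 va vb adj_irrefl pD D in auto)
  qed
  have vert: "x = v \<or> (\<exists>k\<le>n. x = p k)" if x: "x \<in> q ` {..<n + 2}" for x
  proof -
    obtain i where "i < n + 2" "x = q i" using x by auto
    then show ?thesis using q0 qS by (cases i) (auto simp: less_Suc_eq_le)
  qed
  have "inj_on q {..<n + 2}"
  proof (rule inj_onI)
    fix i j assume "i \<in> {..<n + 2}" "j \<in> {..<n + 2}" "q i = q j"
    then show "i = j"
      using pv pv[symmetric] inj_onD[OF inj]
      by (cases i; cases j) (auto simp: q0 qS less_Suc_eq_le)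
  qed
  moreover have "adj (q i) (q (Suc i))" if "i < n + 2" for i
  proof -
    consider "i = 0" | "i = Suc n" | k where "i = Suc k" "k < n"
      using \<open>i < n + 2\<close> by (cases i) (auto, linarith)
    then show ?thesis
      by cases (use q0 qS p0 va vb adj_sym padj in auto)
  qed
  ultimately obtain x y where x: "x \<in> q ` {..<n + 2}" and y: "y \<in> q ` {..<n + 2}"
    and xy: "adj x y" and nc: "\<And>i. i < n + 2 \<Longrightarrow> {x, y} \<noteq> {q i, q (Suc i)}"
    using chord[of "n + 2" q] n2 q0 by auto
  \<comment> \<open>On the path only the two ends are adjacent to \<open>v\<close>, and these edges
    belong to the cycle.\<close>
  have no_v: False if "adj v (p k)" "k \<le> n" "{x, y} = {v, p k}" for k
  proof -
    consider "k = 0" | "k = n" | "0 < k \<and> k < n" using \<open>k \<le> n\<close> by linarith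
    then show False
    proof cases
      case 1 then show False using nc[of 0] that q0 qS[of 0] by auto
    next
      case 2 then show False using nc[of "Suc n"] that q0 qS[of n] by (auto simp: insert_commute)
    next
      case 3 then show False using that D pD by blast
    qed
  qed
  have no_p: False if "k < l" "l \<le> n" "adj (p k) (p l)" "{x, y} = {p k, p l}" for k l
  proof -
    have "l = Suc k" using ind that by blast
    then show False using nc[of "Suc k"] that qS by auto
  qed
  consider "x = v" | "y = v" | k l where "k \<le> n" "l \<le> n" "x = p k" "y = p l"
    using vert[OF x] vert[OF y] by blast
  then show False
  proof cases
    case 1
    then show False using vert[OF y] xy no_v adj_irrefl by blast
  next
    case 2
    then show False using vert[OF x] xy no_v adj_irrefl adj_sym by (metis insert_commute)
  next
    case 3
    then consider "k < l" | "l < k" | "k = l" by linarith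
    then show False
      by cases (use 3 xy no_p adj_irrefl adj_sym insert_commute in metis)+
  qed
qed

text \<open>
  Dirac's argument: the boundary of a component \<open>C\<close> of the non-neighbours of \<open>v\<close> is a clique
  \<open>S\<close>, so a simplicial vertex of \<open>C \<union> S\<close> that lies in \<open>C\<close> is simplicial in the whole graph.
\<close>

lemma simplicial_nonneighbour:
  assumes "finite W" "v \<in> W" "\<exists>x\<in>W. x \<noteq> v \<and> \<not> adj v x"
  shows "\<exists>z\<in>W. z \<noteq> v \<and> \<not> adj v z \<and> simplicial W z"
  using assms
proof (induction W arbitrary: v rule: finite_psubset_induct)
  case (psubset W)
  define D where "D = {x \<in> W. x \<noteq> v \<and> \<not> adj v x}"
  obtain c where "c \<in> D" using psubset.prems by (auto simp: D_def)
  define R where "R = {(x, y). x \<in> D \<and> y \<in> D \<and> adj x y}"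
  define C where "C = R\<^sup>* `` {c}"
  define S where "S = {s \<in> W - C. \<exists>x\<in>C. adj s x}"
  have "c \<in> C" by (simp add: C_def)
  have CD: "C \<subseteq> D"
  proof
    fix x assume "x \<in> C"
    then have "(c, x) \<in> R\<^sup>*" by (simp add: C_def)
    then show "x \<in> D" by (cases rule: rtranclE) (use \<open>c \<in> D\<close> in \<open>auto simp: R_def\<close>)
  qed
  have DC: "y \<in> C" if "x \<in> C" "y \<in> D" "adj x y" for x y
  proof -
    have "(x, y) \<in> R" using that CD by (auto simp: R_def)
    then show ?thesis using \<open>x \<in> C\<close> unfolding C_def by (auto intro: rtrancl_into_rtrancl)
  qed
  \<comment> \<open>A boundary vertex not adjacent to \<open>v\<close> would lie in \<open>D\<close>
    and be absorbed by the component \<open>C\<close>.\<close>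
  have SN: "adj v s" "s \<noteq> v" if sS: "s \<in> S" for s
  proof -
    obtain x where x: "x \<in> C" "adj s x" and s: "s \<in> W" "s \<notin> C" using sS by (auto simp: S_def)
    have "s \<notin> D" using DC x s adj_sym by blast
    moreover show "s \<noteq> v" using x CD by (auto simp: D_def)
    ultimately show "adj v s" using s by (auto simp: D_def)
  qed
  have "sym R" using adj_sym by (auto simp: R_def sym_def)
  have clique: "adj s t" if "s \<in> S" "t \<in> S" "s \<noteq> t" for s t
  proof -
    obtain x y where x: "x \<in> C" "adj s x" and y: "y \<in> C" "adj t y"
      using \<open>s \<in> S\<close> \<open>t \<in> S\<close> by (auto simp: S_def)
    have "(x, c) \<in> R\<^sup>*" using x \<open>sym R\<close> sym_rtrancl[of R] by (auto simp: C_def dest: symD)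
    then have "(x, y) \<in> R\<^sup>*" using y by (auto simp: C_def)
    then obtain k f where f: "f 0 = x" "f k = y" "\<And>i. i < k \<Longrightarrow> (f i, f (Suc i)) \<in> R"
      by (metis rtrancl_imp_relpow relpow_fun_conv)
    have fD: "f i \<in> D" if "i \<le> k" for i
    proof (cases "i = k")
      case True then show ?thesis using f y CD by auto
    next
      case False then show ?thesis using f(3)[of i] that by (auto simp: R_def)
    qed
    \<comment> \<open>A walk inside the component with \<open>s\<close> and \<open>t\<close>
      attached at its ends.\<close>
    define p where "p i = (if i = 0 then s else if i = Suc (Suc k) then t else f (i - 1))" for i
    have "adj (p i) (p (Suc i))" if "i < Suc (Suc k)" for i
    proof -
      consider "i = 0" | "i = Suc k" | j where "i = Suc j" "j < k"
        using \<open>i < Suc (Suc k)\<close> by (cases i) (auto, linarith)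
      then show ?thesis
        by cases (use f x y adj_sym in \<open>auto simp: p_def R_def\<close>)
    qed
    moreover have "p i \<in> D" if "0 < i \<and> i < Suc (Suc k)" for i
      using that fD[of "i - 1"] by (auto simp: p_def)
    ultimately have "walk_via D s p (Suc (Suc k)) t"
      by (auto simp: walk_via_def p_def)
    then show ?thesis
      by (rule adj_if_walk_avoiding_nb[where v = v]) (use SN that in \<open>auto simp: D_def\<close>)
  qed
  have closed: "y \<in> C \<union> S" if "x \<in> C" "y \<in> W" "adj x y" for x y
    using that adj_sym by (auto simp: S_def)
  have "v \<notin> C \<union> S" using CD SN by (auto simp: D_def)
  moreover have sub: "C \<union> S \<subseteq> W" using CD by (auto simp: D_def S_def)
  ultimately have psub: "C \<union> S \<subset> W" "C \<subset> W" using psubset.prems by auto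
  \<comment> \<open>If some \<open>s\<close> in \<open>S\<close> misses a vertex of
    \<open>C \<union> S\<close>, induction at \<open>s\<close> yields a simplicial vertex not
    adjacent to \<open>s\<close>, hence in \<open>C\<close> since \<open>S\<close> is a clique.
    Otherwise \<open>S\<close> is joined to everything, and a vertex simplicial in \<open>C\<close>
    stays so in \<open>C \<union> S\<close>.\<close>
  have "\<exists>z\<in>C. simplicial (C \<union> S) z"
  proof (cases "\<exists>s\<in>S. \<exists>x\<in>C \<union> S. x \<noteq> s \<and> \<not> adj s x")
    case True
    then obtain s where "s \<in> S" "\<exists>x\<in>C \<union> S. x \<noteq> s \<and> \<not> adj s x" by blast
    then obtain z where "z \<in> C \<union> S" "z \<noteq> s" "\<not> adj s z" "simplicial (C \<union> S) z"
      using psubset.IH[OF psub(1), of s] by auto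
    then show ?thesis using clique \<open>s \<in> S\<close> by blast
  next
    case False
    then have univ: "adj s x" if "s \<in> S" "x \<in> C \<union> S" "x \<noteq> s" for s x
      using that by blast
    have "\<exists>z\<in>C. simplicial C z"
    proof (cases "\<exists>x\<in>C. \<exists>y\<in>C. y \<noteq> x \<and> \<not> adj x y")
      case True
      then obtain x where "x \<in> C" "\<exists>y\<in>C. y \<noteq> x \<and> \<not> adj x y" by blast
      from psubset.IH[OF psub(2) this] show ?thesis by blast
    next
      case False
      then have "simplicial C c" by (auto simp: simplicial_def)
      then show ?thesis using \<open>c \<in> C\<close> by blast
    qed
    then obtain z where "z \<in> C" "simplicial C z" ..
    moreover have "simplicial (C \<union> S) z"
      unfolding simplicial_def
    proof (intro ballI impI)
      fix x y assume xy: "x \<in> C \<union> S" "y \<in> C \<union> S" "adj z x \<and> adj z y \<and> x \<noteq> y"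
      consider "x \<in> S" | "y \<in> S" | "x \<in> C" "y \<in> C" using xy(1,2) by blast
      then show "adj x y"
      proof cases
        case 1 then show ?thesis using univ[of x y] xy by auto
      next
        case 2
        then have "adj y x" using univ[of y x] xy by auto
        then show ?thesis by (rule adj_sym)
      next
        case 3 then show ?thesis using \<open>simplicial C z\<close> xy by (simp add: simplicial_def)
      qed
    qed
    ultimately show ?thesis by blast
  qed
  then obtain z where z: "z \<in> C" "simplicial (C \<union> S) z" by blast
  \<comment> \<open>All neighbours of \<open>z\<close> in \<open>W\<close> lie in
    \<open>C \<union> S\<close>.\<close>
  then have "simplicial W z" using closed unfolding simplicial_def by blast
  then show ?case using z CD by (auto simp: D_def)
qed

section \<open>Simplicial vertices and elimination orderings\<close>

lemma simplicial_exists: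
  assumes "finite W" "W \<noteq> {}"
  shows "\<exists>z\<in>W. simplicial W z"
proof (cases "\<exists>v\<in>W. \<exists>x\<in>W. x \<noteq> v \<and> \<not> adj v x")
  case True
  then obtain v where "v \<in> W" "\<exists>x\<in>W. x \<noteq> v \<and> \<not> adj v x" by blast
  from simplicial_nonneighbour[OF assms(1) this] show ?thesis by blast
next
  case False
  then have "\<forall>z. simplicial W z" by (auto simp: simplicial_def)
  then show ?thesis using assms by blast
qed

lemma elimination_ordering_exists:
  assumes "finite W"
  shows "\<exists>vs. distinct vs \<and> set vs = W \<and> (\<forall>i<length vs. simplicial (set (drop i vs)) (vs ! i))"
  using assms
proof (induction W rule: finite_psubset_induct)
  case (psubset W)
  show ?case
  proof (cases "W = {}")
    case True then show ?thesis by simp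
  next
    case False
    then obtain z where z: "z \<in> W" "simplicial W z"
      using simplicial_exists[OF psubset.hyps] by blast
    then have "W - {z} \<subset> W" by blast
    from psubset.IH[OF this] obtain vs where vs: "distinct vs" "set vs = W - {z}"
      "\<forall>i<length vs. simplicial (set (drop i vs)) (vs ! i)"
      by blast
    then have "distinct (z # vs) \<and> set (z # vs) = W" using z by auto
    moreover from this have "\<forall>i<length (z # vs). simplicial (set (drop i (z # vs))) ((z # vs) ! i)"
      using vs(3) z by (auto simp: less_Suc_eq_0_disj)
    ultimately show ?thesis by blast
  qed
qed

end

section \<open>Greedy colouring\<close>

context adjacency
begin

text \<open>For partial colourings, \<open>uniq\<close> and \<open>pcf\<close> take neighbourhoods
  and degrees within \<open>W\<close>; the demand at \<open>w\<close> can thus grow when a vertex is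
  added.\<close>

definition uniq :: "'a set \<Rightarrow> ('a \<Rightarrow> nat) \<Rightarrow> 'a \<Rightarrow> nat set" where
  "uniq W c w = {a. \<exists>!u. u \<in> nb W w \<and> c u = a}"

definition pcf :: "nat \<Rightarrow> nat \<Rightarrow> 'a set \<Rightarrow> ('a \<Rightarrow> nat) \<Rightarrow> bool" where
  "pcf h k W c \<longleftrightarrow> c ` W \<subseteq> {1..k} \<and> (\<forall>u\<in>W. \<forall>w\<in>W. adj u w \<longrightarrow> c u \<noteq> c w) \<and>
     (\<forall>w\<in>W. min (card (nb W w)) h \<le> card (uniq W c w))"

lemma uniq_subset: "uniq W c w \<subseteq> c ` nb W w"
  by (auto simp: uniq_def)

lemma finite_nb: "finite W \<Longrightarrow> finite (nb W w)"
  by (simp add: nb_def)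

lemma finite_uniq: "finite W \<Longrightarrow> finite (uniq W c w)"
  using finite_subset[OF uniq_subset] finite_nb by blast

text \<open>
  If the clique \<open>N\<close> is large compared with \<open>\<Delta>\<close>, then \<open>w \<in> N\<close> has few neighbours outside
  \<open>N\<close>: either they leave \<open>h\<close> colours of \<open>N\<close> unique at \<open>w\<close>, or all of their colours already
  occur in \<open>N\<close> and hence they contribute no unique colour.
\<close>

lemma unique_colours_in_large_clique:
  assumes fin: "finite W" and v: "v \<notin> W" and c: "pcf h k W c"
    and clique: "simplicial W v" and w: "w \<in> nb W v"
    and deg: "card (nb (insert v W) w) \<le> \<Delta>"
    and large: "\<Delta> + h \<le> 2 * card (nb W v)"
  shows "min (card (nb W w)) h \<le> card (uniq W c w \<inter> c ` nb W v)"
proof -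
  let ?N = "nb W v"
  \<comment> \<open>\<open>A\<close> is the rest of the clique, \<open>B\<close> the neighbours of
    \<open>w\<close> outside it; with \<open>v\<close> they form the neighbourhood of
    \<open>w\<close> in \<open>insert v W\<close>.\<close>
  define A where "A = ?N - {w}"
  define B where "B = nb W w - A"
  define P where "P = uniq W c w \<inter> c ` A"
  have wW: "w \<in> W" "adj v w" using w by (auto simp: nb_def)
  have finN: "finite ?N" "finite (nb W w)" using fin finite_nb by auto
  then have finAB: "finite A" "finite B" by (auto simp: A_def B_def)
  have A: "A \<subseteq> nb W w"
    using clique w unfolding A_def simplicial_def nb_def by blast
  have inj: "inj_on c ?N"
    using clique c unfolding inj_on_def simplicial_def pcf_def nb_def by blast
  then have injA: "inj_on c A" by (rule inj_on_subset) (auto simp: A_def)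
  have cA: "card (c ` A) + 1 = card ?N"
    using card_image[OF injA] w finN by (simp add: A_def) (metis Suc_pred card_gt_0_iff empty_iff)
  have "nb (insert v W) w = insert v (A \<union> B)"
    using A wW adj_sym by (auto simp: nb_def B_def)
  moreover have "v \<notin> A \<union> B" using v A by (auto simp: B_def nb_def)
  moreover have "card (A \<union> B) = card A + card B"
    by (rule card_Un_disjoint) (use finAB in \<open>auto simp: B_def\<close>)
  ultimately have cB: "1 + card (c ` A) + card B \<le> \<Delta>"
    using deg finAB card_image[OF injA] by simp
  have P: "c ` A - c ` B \<subseteq> P"
  proof
    fix a assume a: "a \<in> c ` A - c ` B"
    then obtain u where u: "u \<in> A" "a = c u" by blast
    have "x = u" if "x \<in> nb W w" "c x = a" for x
      using that a u injA unfolding B_def inj_on_def by blast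
    then have "a \<in> uniq W c w" using u A by (auto simp: uniq_def)
    then show "a \<in> P" using u by (auto simp: P_def)
  qed
  have "min (card (nb W w)) h \<le> card P"
  proof (cases "h \<le> card P")
    case False
    have finP: "finite P" using finAB by (simp add: P_def)
    have "card (c ` A) = card (c ` A \<inter> c ` B) + card (c ` A - c ` B)"
      using finAB by (simp add: card_Int_Diff)
    moreover have "card (c ` B) = card (c ` A \<inter> c ` B) + card (c ` B - c ` A)"
      using finAB card_Int_Diff[of "c ` B" "c ` A"] by (simp add: Int_commute)
    moreover have "card (c ` B) \<le> card B" using finAB by (simp add: card_image_le)
    moreover have "card (c ` A - c ` B) \<le> card P" using P finP by (simp add: card_mono)
    \<comment> \<open>With \<open>d = card ?N\<close>, \<open>B\<close> has at most
      \<open>\<Delta> - d\<close> colours. As \<open>card P \<le> h - 1\<close>, at least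
      \<open>d - h\<close> of them are shared with \<open>A\<close>, so at most
      \<open>\<Delta> + h - 2 * d \<le> 0\<close> are not.\<close>
    ultimately have "card (c ` B - c ` A) = 0" using cA cB large False by linarith
    then have "c ` B \<subseteq> c ` A" using finAB by simp
    then have "uniq W c w \<subseteq> c ` A"
      using uniq_subset[of W c w] unfolding B_def by blast
    then have "P = uniq W c w" by (auto simp: P_def)
    then show ?thesis using c wW by (simp add: pcf_def)
  qed simp
  also have "card P \<le> card (uniq W c w \<inter> c ` ?N)"
    by (rule card_mono) (use finN in \<open>auto simp: P_def A_def\<close>)
  finally show ?thesis .
qed

text \<open>The two counting hypotheses match the possible sizes of the forbidden set. Protected
  colours drawn from the clique add nothing to its own colours; in general each neighbour of
  \<open>v\<close> contributes its own colour and up to \<open>h\<close> protected ones.\<close>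

lemma pcf_extend:
  assumes fin: "finite W" and v: "v \<notin> W" and c: "pcf h k W c" and clique: "simplicial W v"
    and deg: "\<And>w. w \<in> W \<Longrightarrow> card (nb (insert v W) w) \<le> \<Delta>"
    and small: "card (nb W v) < k"
    and few: "2 * card (nb W v) < \<Delta> + h \<Longrightarrow> card (nb W v) * (h + 1) < k"
  shows "\<exists>c'. pcf h k (insert v W) c'"
proof -
  let ?N = "nb W v"
  have finN: "finite ?N" using fin by (rule finite_nb)
  have NW: "?N \<subseteq> W" by (auto simp: nb_def)
  define large where "large \<longleftrightarrow> \<Delta> + h \<le> 2 * card ?N"
  \<comment> \<open>Protecting exactly the demanded number of colours, not all unique ones, bounds
    each contribution by \<open>h\<close>.\<close>
  have "\<exists>S. S \<subseteq> uniq W c w \<and> card S = min (card (nb W w)) h \<and> (large \<longrightarrow> S \<subseteq> c ` ?N)"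
    if w: "w \<in> ?N" for w
  proof (cases large)
    case True
    then have "min (card (nb W w)) h \<le> card (uniq W c w \<inter> c ` ?N)"
      using unique_colours_in_large_clique[OF fin v c clique w] deg w NW
      by (auto simp: large_def)
    then show ?thesis by (meson obtain_subset_with_card_n le_inf_iff)
  next
    case False
    have "min (card (nb W w)) h \<le> card (uniq W c w)" using c w NW by (auto simp: pcf_def)
    then show ?thesis using False by (meson obtain_subset_with_card_n)
  qed
  then obtain S where S: "\<And>w. w \<in> ?N \<Longrightarrow> S w \<subseteq> uniq W c w"
    and cardS: "\<And>w. w \<in> ?N \<Longrightarrow> card (S w) = min (card (nb W w)) h"
    and SN: "\<And>w. w \<in> ?N \<Longrightarrow> large \<Longrightarrow> S w \<subseteq> c ` ?N"
    by metis
  define F where "F = c ` ?N \<union> (\<Union>w\<in>?N. S w)"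
  have cN: "card (c ` ?N) \<le> card ?N" using finN by (rule card_image_le)
  have "card F < k"
  proof (cases large)
    case True
    then have "F = c ` ?N" using SN by (auto simp: F_def)
    then show ?thesis using cN small by simp
  next
    case False
    have "card F \<le> card (c ` ?N) + card (\<Union>w\<in>?N. S w)" unfolding F_def by (rule card_Un_le)
    also have "card (\<Union>w\<in>?N. S w) \<le> (\<Sum>w\<in>?N. card (S w))" using finN by (rule card_UN_le)
    also have "\<dots> \<le> (\<Sum>w\<in>?N. h)" by (rule sum_mono) (simp add: cardS)
    finally have "card F \<le> card ?N * (h + 1)" using cN by simp
    then show ?thesis using few False by (simp add: large_def)
  qed
  moreover have "finite F"
  proof -
    have "finite (S w)" if "w \<in> ?N" for w
      using S[OF that] finite_uniq[OF fin] finite_subset by blast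
    then show ?thesis using finN by (simp add: F_def)
  qed
  ultimately have "\<not> {1..k} \<subseteq> F" using card_mono[of F "{1..k}"] by auto
  then obtain a where a: "a \<in> {1..k}" "a \<notin> F" by blast
  define c' where "c' = c(v := a)"
  have c'v: "c' v = a" and c'W: "\<And>u. u \<in> W \<Longrightarrow> c' u = c u" using v by (auto simp: c'_def)
  have proper: "c' u \<noteq> c' w" if "u \<in> insert v W" "w \<in> insert v W" "adj u w" for u w
  proof -
    have va: "c x \<noteq> a" if "x \<in> W" "adj v x" for x using a that by (auto simp: F_def nb_def)
    show ?thesis
      using that c va c'v c'W adj_irrefl adj_sym unfolding pcf_def by (metis insert_iff)
  qed
  have cf: "min (card (nb (insert v W) w)) h \<le> card (uniq (insert v W) c' w)"
    if w: "w \<in> insert v W" for w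
  proof -
    have fin': "finite (uniq (insert v W) c' w)" using fin finite_uniq by simp
    consider "w = v" | "w \<in> W" "\<not> adj v w" | "w \<in> ?N" using w by (auto simp: nb_def)
    then show ?thesis
    proof cases
      case 1
      have nbv: "nb (insert v W) v = ?N" using adj_irrefl by (auto simp: nb_def)
      \<comment> \<open>The neighbours of \<open>v\<close> form a clique, so each of their colours
        is unique at \<open>v\<close>.\<close>
      have inj: "inj_on c' ?N"
        using clique proper unfolding inj_on_def simplicial_def nb_def by blast
      have "c' ` ?N \<subseteq> uniq (insert v W) c' v"
        using inj unfolding uniq_def nbv inj_on_def by blast
      then have "card (c' ` ?N) \<le> card (uniq (insert v W) c' v)"
        using fin' 1 by (simp add: card_mono)
      then show ?thesis using 1 nbv card_image[OF inj] by simp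
    next
      case 2
      then have nbw: "nb (insert v W) w = nb W w" using adj_sym by (auto simp: nb_def)
      moreover have "uniq (insert v W) c' w = uniq W c w"
        unfolding uniq_def nbw using c'W by (metis (no_types, lifting) mem_Collect_eq nb_def)
      ultimately show ?thesis using c 2 by (simp add: pcf_def)
    next
      case 3
      then have nbw: "nb (insert v W) w = insert v (nb W w)" using adj_sym by (auto simp: nb_def)
      have vn: "v \<notin> nb W w" using v by (simp add: nb_def)
      have finw: "finite (nb W w)" using fin by (rule finite_nb)
      have aS: "a \<notin> S w" using a 3 by (auto simp: F_def)
      have c'n: "c' u = c u" if "u \<in> nb W w" for u using that c'W by (simp add: nb_def)
      have old: "S w \<subseteq> uniq (insert v W) c' w"
      proof
        fix b assume b: "b \<in> S w"
        then have "b \<noteq> a" "b \<in> uniq W c w" using aS S 3 by auto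
        then show "b \<in> uniq (insert v W) c' w"
          unfolding uniq_def nbw using c'v c'n vn by auto
      qed
      show ?thesis
      \<comment> \<open>With at least \<open>h\<close> old neighbours the demand stays
        \<open>h\<close> and \<open>S w\<close> meets it. Otherwise the demand rises by one, but
        \<open>S w\<close> holds every colour around \<open>w\<close>, so \<open>a\<close> is new
        there and becomes the extra unique colour.\<close>
      proof (cases "h \<le> card (nb W w)")
        case True
        then have "card (S w) = h" using cardS 3 by simp
        then show ?thesis using card_mono[OF fin' old] by simp
      next
        case False
        then have cS: "card (S w) = card (nb W w)" using cardS 3 by simp
        have "S w = c ` nb W w"
        proof (rule card_seteq)
          show "S w \<subseteq> c ` nb W w" using S 3 uniq_subset by blast
          show "card (c ` nb W w) \<le> card (S w)" using finw cS by (simp add: card_image_le)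
        qed (use finw in simp)
        then have "c u \<noteq> a" if "u \<in> nb W w" for u using aS that by blast
        then have "a \<in> uniq (insert v W) c' w"
          unfolding uniq_def nbw using c'v c'n by (intro CollectI ex1I[of _ v]) auto
        then have "insert a (S w) \<subseteq> uniq (insert v W) c' w" using old by simp
        then have "card (insert a (S w)) \<le> card (uniq (insert v W) c' w)"
          using fin' by (rule card_mono[rotated])
        moreover have "finite (S w)" using old fin' finite_subset by blast
        ultimately show ?thesis using aS cS nbw vn finw by simp
      qed
    qed
  qed
  have "c' ` insert v W \<subseteq> {1..k}" using c a c'v c'W by (auto simp: pcf_def)
  then have "pcf h k (insert v W) c'" using proper cf unfolding pcf_def by blast
  then show ?thesis by blast
qed

text \<open>Induction on the list colours from its tail, so \<open>vs ! i\<close> meets only the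
  neighbours that follow it.\<close>

lemma pcf_exists:
  assumes "distinct vs"
    and "\<And>i. i < length vs \<Longrightarrow> simplicial (set (drop i vs)) (vs ! i)"
    and "\<And>w. w \<in> set vs \<Longrightarrow> card (nb (set vs) w) \<le> \<Delta>"
    and "\<And>i. i < length vs \<Longrightarrow> card (nb (set (drop i vs)) (vs ! i)) < k"
    and "\<And>i. i < length vs \<Longrightarrow> 2 * card (nb (set (drop i vs)) (vs ! i)) < \<Delta> + h \<Longrightarrow>
      card (nb (set (drop i vs)) (vs ! i)) * (h + 1) < k"
  shows "\<exists>c. pcf h k (set vs) c"
  using assms
proof (induction vs)
  case Nil
  then show ?case by (simp add: pcf_def)
next
  case (Cons v vs)
  have deg: "card (nb (insert v (set vs)) w) \<le> \<Delta>" if "w \<in> set vs" for w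
    using Cons.prems(3)[of w] that by simp
  have "card (nb (set vs) w) \<le> \<Delta>" if "w \<in> set vs" for w
  proof -
    have "card (nb (set vs) w) \<le> card (nb (insert v (set vs)) w)"
      by (rule card_mono) (auto simp: nb_def)
    also have "\<dots> \<le> \<Delta>" using that by (rule deg)
    finally show ?thesis .
  qed
  then have "\<exists>c. pcf h k (set vs) c"
    using Cons.IH Cons.prems(1) Cons.prems(2,4,5)[of "Suc i" for i] by simp
  then obtain c where c: "pcf h k (set vs) c" ..
  have nbv: "nb (insert v (set vs)) v = nb (set vs) v"
    using adj_irrefl by (auto simp: nb_def)
  have "simplicial (set vs) v" using Cons.prems(2)[of 0] by (auto simp: simplicial_def)
  then have "\<exists>c. pcf h k (insert v (set vs)) c"
    by (intro pcf_extend[OF _ _ c, where \<Delta> = \<Delta>] deg)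
      (use Cons.prems(1) Cons.prems(4,5)[of 0] nbv in simp_all)
  then show ?case by simp
qed

end

section \<open>Transfer to digraphs\<close>

lemma dominates_induce_subgraph_iff:
  "u \<rightarrow>\<^bsub>G \<restriction> S\<^esub> w \<longleftrightarrow> u \<rightarrow>\<^bsub>G\<^esub> w \<and> u \<in> S \<and> w \<in> S"
  by (auto simp: arcs_ends_def arc_to_ends_def image_iff)

text \<open>Choosing an arc for each step turns an index cycle into an arc list. Every cycle edge
  then occurs in the list in one orientation, so a chord in the sense of \<open>has_chord\<close> is
  no pair of consecutive vertices.\<close>

lemma (in graph) chordal_adjacency_dominates:
  assumes "chordal G"
  shows "chordal_adjacency (\<lambda>u v. u \<rightarrow>\<^bsub>G\<^esub> v)"
proof unfold_locales
  show "u \<rightarrow>\<^bsub>G\<^esub> v \<Longrightarrow> v \<rightarrow>\<^bsub>G\<^esub> u" for u v by (rule graph_symmetric)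
  show "\<not> v \<rightarrow>\<^bsub>G\<^esub> v" for v using adj_not_same by blast
next
  fix m :: nat and q :: "nat \<Rightarrow> 'a"
  assume m: "4 \<le> m" and inj: "inj_on q {..<m}" and qm: "q m = q 0"
    and adj: "\<forall>i<m. q i \<rightarrow>\<^bsub>G\<^esub> q (Suc i)"
  have "\<forall>i. \<exists>e. i < m \<longrightarrow> e \<in> arcs G \<and> tail G e = q i \<and> head G e = q (Suc i)"
    using adj by (fastforce simp: arcs_ends_def arc_to_ends_def)
  then obtain e where e: "\<And>i. i < m \<Longrightarrow> e i \<in> arcs G" "\<And>i. i < m \<Longrightarrow> tail G (e i) = q i"
    "\<And>i. i < m \<Longrightarrow> head G (e i) = q (Suc i)"
    by metis
  define p where "p = map e [0..<m]"
  have "cas (q i) (map e [i..<m]) (q m)" if "i \<le> m" for i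
    using that by (induction rule: inc_induct) (simp_all add: e upt_conv_Cons)
  from this[of 0] have cas: "cas (q 0) p (q 0)" using qm by (simp add: p_def)
  have "p \<noteq> []" using m by (simp add: p_def)
  have "map (head G) p = map (q \<circ> Suc) [0..<m]" by (simp add: p_def e)
  \<comment> \<open>\<open>cycle\<close> asks for distinct heads \<open>q 1, ..., q m\<close>, a
    rotation of \<open>q 0, ..., q (m - 1)\<close>.\<close>
  moreover have "inj_on (q \<circ> Suc) {..<m}"
  proof (rule linorder_inj_onI)
    fix i j assume ij: "i < j" "i \<in> {..<m}" "j \<in> {..<m}"
    show "(q \<circ> Suc) i \<noteq> (q \<circ> Suc) j"
    proof (cases "Suc j = m")
      case True
      then show ?thesis using ij inj qm by (auto simp: inj_on_def)
    next
      case False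
      then have "Suc i < m" "Suc j < m" using ij by auto
      then show ?thesis using ij inj by (auto simp: inj_on_def)
    qed
  qed auto
  ultimately have "distinct (map (head G) p)" by (simp add: distinct_map atLeast0LessThan)
  then have "distinct (tl (awalk_verts (q 0) p))"
    using awalk_verts_conv'[OF cas] \<open>p \<noteq> []\<close> by simp
  moreover have "awalk (q 0) p (q 0)"
  proof -
    have "q 0 \<in> verts G" using e(1,2)[of 0] m tail_in_verts[of "e 0"] by simp
    then show ?thesis using cas e(1) by (auto simp: awalk_def p_def)
  qed
  ultimately have "cycle p" using \<open>p \<noteq> []\<close> by (auto simp: cycle_def)
  then have "has_chord G p" using assms m by (simp add: chordal_def p_def)
  then obtain x y where xy: "x \<in> tail G ` set p" "y \<in> tail G ` set p" "x \<rightarrow>\<^bsub>G\<^esub> y"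
    "(x, y) \<notin> arc_to_ends G ` set p" "(y, x) \<notin> arc_to_ends G ` set p"
    by (auto simp: has_chord_def)
  have "tail G ` set p = q ` {..<m}"
    using e(2) by (auto simp: p_def image_image atLeast0LessThan)
  moreover have "(q i, q (Suc i)) \<in> arc_to_ends G ` set p" if "i < m" for i
    using e that by (force simp: p_def arc_to_ends_def)
  ultimately show "\<exists>x \<in> q ` {..<m}. \<exists>y \<in> q ` {..<m}. x \<rightarrow>\<^bsub>G\<^esub> y \<and> (\<forall>i<m. {x, y} \<noteq> {q i, q (Suc i)})"
    using xy by (intro bexI[of _ x] bexI[of _ y]) (auto simp: doubleton_eq_iff)
qed

section \<open>The bound on \<open>chi_pcf\<close>\<close>

theorem theorem1p5:
  fixes G :: "('a, 'b) pre_digraph" and h :: nat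
  assumes "graph G" and "verts G \<noteq> {}" and "chordal G" and "h \<ge> 1"
  shows "real (chi_pcf h G) \<le>
    1 + (real h + 1) *
      min (real (max_simplicial_clique G) - 1)
          ((real (max_degree G) + real h - 1) / 2)"
proof -
  interpret graph G by fact
  interpret A: chordal_adjacency "\<lambda>u v. u \<rightarrow>\<^bsub>G\<^esub> v"
    using chordal_adjacency_dominates assms(3) .
  obtain vs where vs: "distinct vs" "set vs = verts G"
    and simp: "\<And>i. i < length vs \<Longrightarrow> A.simplicial (set (drop i vs)) (vs ! i)"
    using A.elimination_ordering_exists[OF finite_verts] by blast
  define N where "N i = A.nb (set (drop i vs)) (vs ! i)" for i
  define s where "s = max_simplicial_clique G"
  define \<Delta> where "\<Delta> = max_degree G"
  define X where "X = (real h + 1) * min (real s - 1) ((real \<Delta> + real h - 1) / 2)"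
  have nbhd: "nbhd G w = A.nb (verts G) w" for w
    by (auto simp: nbhd_def A.nb_def adj_in_verts)
  have degree: "degree G w \<le> \<Delta>" if "w \<in> verts G" for w
    unfolding \<Delta>_def max_degree_def by (rule Max_ge) (use that in auto)
  have first: "vs ! i \<in> set (drop i vs)" if "i < length vs" for i
    using that by (simp add: Cons_nth_drop_Suc[symmetric])
  have subset: "set (drop i vs) \<subseteq> verts G" for i
    using vs(2) set_drop_subset by metis
  have nbhd_drop: "nbhd (G \<restriction> set (drop i vs)) (vs ! i) = N i" if "i < length vs" for i
    using first[OF that] by (auto simp: nbhd_def N_def A.nb_def dominates_induce_subgraph_iff)
  have clique: "is_clique (G \<restriction> set (drop i vs)) (insert (vs ! i) (N i))"
    if "i < length vs" for i
    using first[OF that] simp[OF that] A.adj_sym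
    unfolding is_clique_def N_def A.nb_def A.simplicial_def dominates_induce_subgraph_iff
      induce_subgraph_verts by blast
  have "simplicial_ordering G vs"
    using vs clique nbhd_drop by (simp add: simplicial_ordering_def Let_def)
  \<comment> \<open>Every clique containing \<open>vs ! i\<close> lies in its closed
    neighbourhood.\<close>
  moreover have "maximal_clique (G \<restriction> set (drop i vs)) (insert (vs ! i) (N i))"
    if "i < length vs" for i
    unfolding maximal_clique_def
  proof (intro conjI allI impI)
    fix L assume "is_clique (G \<restriction> set (drop i vs)) L \<and> insert (vs ! i) (N i) \<subseteq> L"
    then show "L = insert (vs ! i) (N i)"
      by (auto simp: is_clique_def N_def A.nb_def dominates_induce_subgraph_iff)
  qed (rule clique[OF that])
  ultimately have sc: "simplicial_clique G (insert (vs ! i) (N i))" if "i < length vs" for i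
    using that unfolding simplicial_clique_def by blast
  have finite_sc: "finite {K. simplicial_clique G K}"
  proof (rule finite_subset)
    show "{K. simplicial_clique G K} \<subseteq> Pow (verts G)"
    proof clarify
      fix K x assume "simplicial_clique G K" "x \<in> K"
      then obtain us i where "simplicial_ordering G us" "K \<subseteq> set (drop i us)"
        by (auto simp: simplicial_clique_def maximal_clique_def is_clique_def)
      then show "x \<in> verts G"
        using \<open>x \<in> K\<close> by (auto simp: simplicial_ordering_def dest: in_set_dropD)
    qed
  qed simp
  have N_s: "card (N i) + 1 \<le> s" if "i < length vs" for i
  proof -
    have "finite (N i)" "vs ! i \<notin> N i" using A.adj_irrefl by (auto simp: N_def A.nb_def)
    then have "card (N i) + 1 = card (insert (vs ! i) (N i))" by simp
    also have "\<dots> \<le> s"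
      unfolding s_def max_simplicial_clique_def
      by (rule Max_ge) (use finite_sc sc[OF that] in auto)
    finally show ?thesis .
  qed
  have N_\<Delta>: "card (N i) \<le> \<Delta>" if "i < length vs" for i
  proof -
    have "card (N i) \<le> degree G (vs ! i)"
      unfolding degree_def nbhd
      by (rule card_mono) (use subset A.finite_nb in \<open>auto simp: N_def A.nb_def\<close>)
    also have "\<dots> \<le> \<Delta>" using degree that vs(2) nth_mem by blast
    finally show ?thesis .
  qed
  \<comment> \<open>For the first term of the minimum \<open>h + 1 \<ge> 1\<close> suffices; for the
    second, \<open>h \<ge> 1\<close> gives \<open>h + 1 \<ge> 2\<close> and
    \<open>\<Delta> \<le> \<Delta> + h - 1\<close>.\<close>
  have N_X: "real (card (N i)) \<le> X" if "i < length vs" for i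
  proof -
    have "real (card (N i)) \<le> real s - 1" using N_s[OF that] by simp
    also have "\<dots> \<le> (real h + 1) * (real s - 1)"
      using N_s[OF that] by (simp add: mult_le_cancel_right1)
    finally have 1: "real (card (N i)) \<le> (real h + 1) * (real s - 1)" .
    have "real (card (N i)) \<le> 2 * ((real \<Delta> + real h - 1) / 2)"
      using N_\<Delta>[OF that] assms(4) by simp
    also have "\<dots> \<le> (real h + 1) * ((real \<Delta> + real h - 1) / 2)"
      by (rule mult_right_mono) (use assms(4) in auto)
    finally show ?thesis using 1 by (simp add: X_def min_def)
  qed
  have N_h_X: "real (card (N i) * (h + 1)) \<le> X"
    if i: "i < length vs" and few: "2 * card (N i) < \<Delta> + h" for i
  proof -
    \<comment> \<open>By integrality \<open>few\<close> reads
      \<open>2 * card (N i) \<le> \<Delta> + h - 1\<close>.\<close>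
    have "real (card (N i)) \<le> min (real s - 1) ((real \<Delta> + real h - 1) / 2)"
      using N_s[OF i] few by simp
    then have "(real h + 1) * real (card (N i)) \<le> X"
      unfolding X_def by (rule mult_left_mono) simp
    then show ?thesis by (simp add: algebra_simps)
  qed
  \<comment> \<open>Forbidden sets have at most \<open>X\<close> colours, so the floor of
    \<open>X\<close> plus one leaves a free colour.\<close>
  define k where "k = 1 + nat \<lfloor>X\<rfloor>"
  have less_k: "n < k" if "real n \<le> X" for n
    using le_nat_floor[OF that] by (simp add: k_def)
  have "\<exists>c. A.pcf h k (set vs) c"
  proof (rule A.pcf_exists[where \<Delta> = \<Delta>])
    show "card (A.nb (set vs) w) \<le> \<Delta>" if "w \<in> set vs" for w
      using degree[of w] that vs(2) by (simp add: degree_def nbhd)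
  qed (use vs simp less_k N_X N_h_X in \<open>auto simp flip: N_def\<close>)
  then obtain c where c: "A.pcf h k (verts G) c" using vs(2) by auto
  have "A.uniq (verts G) c w = unique_colors G c w" for w
    by (simp add: A.uniq_def unique_colors_def nbhd)
  then have "proper_cf_coloring G h k c"
    using c adj_in_verts
    by (auto simp: A.pcf_def proper_cf_coloring_def proper_coloring_def degree_def nbhd)
  then have "chi_pcf h G \<le> k" unfolding chi_pcf_def by (blast intro: Least_le)
  \<comment> \<open>\<open>nat\<close> truncates negative values to 0, so \<open>0 \<le> X\<close>
    must be known; it comes from \<open>N_X\<close> at the first vertex of the nonempty
    graph.\<close>
  moreover have "real k \<le> 1 + X"
  proof -
    have "0 < length vs" using vs(2) assms(2) by auto
    then have "0 \<le> X" using N_X[of 0] by linarith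
    then show ?thesis by (simp add: k_def of_nat_floor)
  qed
  ultimately show ?thesis unfolding X_def s_def \<Delta>_def by linarith
qed

end
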